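(* Let $T$ be an integral domain of the form $T=K+M$, where $K$ is a subfield of $T$ and $M$ is a nonzero maximal ideal of $T$. Let $D$ be a subring of $K$ and $R=D+M$. Assume that $D$ is not a field. Then the following statements hold. (1) $R$ is a Furstenberg domain if and only if $D$ is a Furstenberg domain and every nonunit of $R$ of the form $1+m$, where $m\in M$, has at least one irreducible divisor in $R$. (2) If $R$ is a Furstenberg domain (resp., a strong Furstenberg domain), then $D$ is a Furstenberg domain (resp., a strong Furstenberg domain). (3) If $D$ and $T$ are Furstenberg domains (resp., strong Furstenberg domains), then $R$ is a Furstenberg domain (resp., a strong Furstenberg domain). (4) If $R$ is a PDF-domain, then $\mathcal{P}(D)$ is finite up to associates. (5) If $T$ is a PDF-domain and $\mathcal{P}(D)$ is finite up to associates, then $R$ is a PDF-domain. (6) If $R$ is a TPDF-domain, then $D$ is a TPDF-domain and $\mathcal{P}(D)$ is finite up to associates. (7) If $T$ and $D$ are TPDF-domains and $\mathcal{P}(D)$ is (nonempty and) finite up to associates, then $R$ is a TPDF-domain.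
   Context: For an integral domain $A$: an irreducible element of $A$ is a nonunit $a$ such that $a=bc$ implies that $b$ or $c$ is a unit of $A$; a prime element of $A$ is a nonzero nonunit $p$ such that $p\mid ab$ implies $p\mid a$ or $p\mid b$. $\mathcal{P}(A)$ denotes the set of prime elements of $A$; it is finite up to associates if there are only finitely many associate classes of prime elements. $A$ is a Furstenberg domain (resp., strong Furstenberg domain) if every nonzero nonunit of $A$ has at least one irreducible (resp., prime) divisor in $A$. $A$ is a PDF-domain if every nonzero element of $A$ has only finitely many prime divisors up to associates. $A$ is a TPDF-domain if it is a strong Furstenberg domain and a PDF-domain. Subrings contain the identity $1$. *)

theory Defs
  imports "HOL-Algebra.Algebra"
begin

(* \<open>ring_irreducible\<close> is defined through proper factors; this is its description
   through factorizations. *)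
lemma (in domain) ring_irreducible_iff:
  assumes "a \<in> carrier R"
  shows "ring_irreducible a \<longleftrightarrow>
    a \<notin> Units R \<and>
    (\<forall>b\<in>carrier R. \<forall>c\<in>carrier R. a = b \<otimes> c \<longrightarrow> b \<in> Units R \<or> c \<in> Units R)"
proof
  assume "ring_irreducible a"
  then show "a \<notin> Units R \<and>
    (\<forall>b\<in>carrier R. \<forall>c\<in>carrier R. a = b \<otimes> c \<longrightarrow> b \<in> Units R \<or> c \<in> Units R)"
    using ring_irreducibleE[OF assms] by blast
next
  assume h: "a \<notin> Units R \<and>
    (\<forall>b\<in>carrier R. \<forall>c\<in>carrier R. a = b \<otimes> c \<longrightarrow> b \<in> Units R \<or> c \<in> Units R)"
  have "a \<noteq> \<zero>"
  proof
    assume a: "a = \<zero>"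
    have "\<zero> = \<zero> \<otimes> \<zero>" by simp
    then have "\<zero> \<in> Units R" using h unfolding a by (metis zero_closed)
    then show False using h unfolding a by simp
  qed
  then show "ring_irreducible a"
    using h assms by (intro ring_irreducibleI) auto
qed

definition prime_elements :: "('a, 'b) ring_scheme \<Rightarrow> 'a set" where
  "prime_elements A = {p \<in> carrier A. ring_prime\<^bsub>A\<^esub> p}"

definition finite_up_to_associates :: "('a, 'b) ring_scheme \<Rightarrow> 'a set \<Rightarrow> bool" where
  "finite_up_to_associates A S \<longleftrightarrow> finite (assocs A ` S)"

locale furstenberg_domain = domain +
  assumes exists_irreducible_divisor:
    "\<lbrakk>a \<in> carrier R; a \<noteq> \<zero>; a \<notin> Units R\<rbrakk>
      \<Longrightarrow> \<exists>p \<in> carrier R. ring_irreducible p \<and> p divides a"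

locale strong_furstenberg_domain = domain +
  assumes exists_prime_divisor:
    "\<lbrakk>a \<in> carrier R; a \<noteq> \<zero>; a \<notin> Units R\<rbrakk>
      \<Longrightarrow> \<exists>p \<in> carrier R. ring_prime p \<and> p divides a"

locale pdf_domain = domain +
  assumes finite_prime_divisors:
    "\<lbrakk>a \<in> carrier R; a \<noteq> \<zero>\<rbrakk>
      \<Longrightarrow> finite_up_to_associates R {p \<in> prime_elements R. p divides a}"

locale tpdf_domain = strong_furstenberg_domain + pdf_domain

end

theory Submission
  imports Defs
begin

text \<open>
  Since a proper ideal contains no nonzero element of the field \<open>K\<close>, the decomposition
  \<open>T = K + M\<close> is direct, and its projection \<open>\<rho> : T \<rightarrow> K\<close> is a ring homomorphism that is the
  identity on \<open>K\<close> and has kernel \<open>M\<close> (lemma \<open>complement_retraction\<close>). In terms of \<open>\<rho>\<close>, the ring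
  \<open>R = D + M\<close> is the preimage of \<open>D\<close>, and \<open>1 + M\<close> is the set of \<open>u\<close> with \<open>\<rho> u = 1\<close>. The
  rest is a multiplicative argument: every \<open>x\<close> outside \<open>M\<close> is a product
  \<open>x = \<rho> x \<cdot> \<nu> x\<close> of a constant and an element \<open>\<nu> x\<close> of \<open>1 + M\<close>, and divisibility in \<open>R\<close> is
  governed by each factor separately.

  \<^item> A nonzero constant \<open>d\<close> of \<open>D\<close> divides \<open>x\<close> in \<open>R\<close> iff it divides \<open>\<rho> x\<close> in \<open>D\<close>, because the only
    candidate for the quotient is \<open>d\<inverse> x\<close>, and \<open>\<rho>\<close> maps it to \<open>d\<inverse> (\<rho> x)\<close>.
  \<^item> An element \<open>u\<close> of \<open>1 + M\<close> divides \<open>x\<close> in \<open>R\<close> iff it does so in \<open>T\<close>, because a quotient has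
    the same image under \<open>\<rho>\<close> as \<open>x\<close>.

  Hence a constant is irreducible (prime) in \<open>R\<close> iff it is so in \<open>D\<close>, and an element of \<open>1 + M\<close> is
  irreducible (prime) in \<open>R\<close> iff it is so in \<open>T\<close>. As \<open>D\<close> is not a field, it has a nonzero nonunit
  \<open>d\<close>; each \<open>m\<close> in \<open>M\<close> factors as \<open>d \<cdot> (d\<inverse> m)\<close> in \<open>R\<close>, so no element of \<open>M\<close> is irreducible or
  prime. An irreducible (prime) \<open>p\<close> is not a product of two nonunits, so every irreducible
  (prime) of \<open>R\<close> is associated to its constant \<open>\<rho> p\<close> or to its factor \<open>\<nu> p\<close> in \<open>1 + M\<close>.

  The statements on Furstenberg and strong Furstenberg domains use only these common properties
  of irreducible and prime elements, so they are proved once for an abstract kind of divisor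
  (locale \<open>divisor_kind\<close>). For the statements on prime divisors up to associates, note that all
  primes of \<open>D\<close> divide any given nonzero element of \<open>M\<close>, which bounds the primes of \<open>D\<close> if \<open>R\<close> is a
  PDF-domain; conversely the prime divisors of \<open>x\<close> in \<open>R\<close> split into those associated to primes
  of \<open>D\<close> and those associated to prime divisors of \<open>x\<close> in \<open>T\<close>.
\<close>

section \<open>Irreducible and prime divisors in a domain\<close>

text \<open>
  The predicate \<open>P\<close> takes the ring as an argument, so that the same notion of divisor can be
  compared across \<open>D\<close>, \<open>R\<close> and \<open>T\<close>.
\<close>
definition every_nonunit_has_divisor ::
    "(('a, 'b) ring_scheme \<Rightarrow> 'a \<Rightarrow> bool) \<Rightarrow> ('a, 'b) ring_scheme \<Rightarrow> bool" where
  "every_nonunit_has_divisor P A \<longleftrightarrow>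
    (\<forall>a\<in>carrier A. a \<noteq> \<zero>\<^bsub>A\<^esub> \<longrightarrow> a \<notin> Units A \<longrightarrow> (\<exists>p\<in>carrier A. P A p \<and> p divides\<^bsub>A\<^esub> a))"

lemma furstenberg_domain_iff:
  assumes "domain A"
  shows "furstenberg_domain A \<longleftrightarrow> every_nonunit_has_divisor (\<lambda>A. ring_irreducible\<^bsub>A\<^esub>) A"
  using assms
  by (auto simp: furstenberg_domain_def furstenberg_domain_axioms_def every_nonunit_has_divisor_def)

lemma strong_furstenberg_domain_iff:
  assumes "domain A"
  shows "strong_furstenberg_domain A \<longleftrightarrow> every_nonunit_has_divisor (\<lambda>A. ring_prime\<^bsub>A\<^esub>) A"
  using assms
  by (auto simp: strong_furstenberg_domain_def strong_furstenberg_domain_axioms_def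
      every_nonunit_has_divisor_def)

lemma (in domain) ring_irreducible_mult_cases:
  assumes "a \<in> carrier R" "b \<in> carrier R" "ring_irreducible (a \<otimes> b)"
  shows "a \<in> Units R \<and> ring_irreducible b \<or> b \<in> Units R \<and> ring_irreducible a"
proof -
  have *: "ring_irreducible d"
    if c: "c \<in> Units R" and d: "d \<in> carrier R" and irr: "ring_irreducible (c \<otimes> d)" for c d
  proof -
    have cR: "c \<in> carrier R" using c by (rule Units_closed)
    have cd: "c \<otimes> d \<notin> Units R"
      "\<And>x y. \<lbrakk>x \<in> carrier R; y \<in> carrier R; c \<otimes> d = x \<otimes> y\<rbrakk> \<Longrightarrow> x \<in> Units R \<or> y \<in> Units R"
      using irr ring_irreducible_iff[of "c \<otimes> d"] cR d by auto
    have "x \<in> Units R \<or> y \<in> Units R" if x: "x \<in> carrier R" and y: "y \<in> carrier R" and "d = x \<otimes> y" for x y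
    proof -
      have "c \<otimes> d = (c \<otimes> x) \<otimes> y" using \<open>d = x \<otimes> y\<close> cR x y by (simp add: m_assoc)
      then have "c \<otimes> x \<in> Units R \<or> y \<in> Units R" using cd(2) cR x y by blast
      then show ?thesis using prod_unit_l[OF _ c cR x] by blast
    qed
    moreover have "d \<notin> Units R" using cd(1) c by blast
    ultimately show ?thesis using ring_irreducible_iff[OF d] by blast
  qed
  have "a \<in> Units R \<or> b \<in> Units R"
    using ring_irreducibleE(5)[OF _ assms(3)] assms(1,2) by blast
  then show ?thesis
    using *[of a b] *[of b a] assms m_comm[OF assms(1,2)] by metis
qed

text \<open>
  A prime product divides one of its factors; cancelling that factor shows that the other one is
  a unit, so the product and the remaining factor have the same multiples.
\<close>
lemma (in domain) ring_prime_mult_cases: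
  assumes "a \<in> carrier R" "b \<in> carrier R" "ring_prime (a \<otimes> b)"
  shows "a \<in> Units R \<and> ring_prime b \<or> b \<in> Units R \<and> ring_prime a"
proof -
  have pr: "prime R (a \<otimes> b)" and nz: "a \<otimes> b \<noteq> \<zero>"
    using assms(3) unfolding ring_prime_def by auto
  have nz': "a \<noteq> \<zero>" "b \<noteq> \<zero>" using nz assms by auto
  have *: "c \<in> Units R \<and> ring_prime d"
    if c: "c \<in> carrier R" "c \<noteq> \<zero>" and d: "d \<in> carrier R" "d \<noteq> \<zero>"
      and prcd: "prime R (c \<otimes> d)" and dv: "(c \<otimes> d) divides d" for c d
  proof -
    obtain e where e: "e \<in> carrier R" "d = c \<otimes> d \<otimes> e" using dv by blast
    have "d \<otimes> \<one> = d \<otimes> (c \<otimes> e)" using e c d by (simp add: m_ac)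
    then have "c \<otimes> e = \<one>" using m_lcancel[of d \<one> "c \<otimes> e"] c d e by simp
    then have cU: "c \<in> Units R" using unit_factor[of c e] c e by simp
    have "d divides (c \<otimes> d)" using c d m_comm[of c d] by blast
    then have eq: "(c \<otimes> d) divides x \<longleftrightarrow> d divides x" for x
      using dv divides_trans[of _ _ x] c d by blast
    have "d \<notin> Units R" using prcd cU unfolding prime_def by auto
    then have "prime R d" using prcd eq unfolding prime_def by simp
    then show ?thesis using cU d unfolding ring_prime_def by simp
  qed
  have "(a \<otimes> b) divides a \<or> (a \<otimes> b) divides b"
    using pr assms(1,2) divides_refl[of "a \<otimes> b"] unfolding prime_def by blast
  moreover have "b \<otimes> a = a \<otimes> b" using m_comm[OF assms(2,1)] .
  ultimately show ?thesis
    using *[OF assms(1) nz'(1) assms(2) nz'(2) pr] *[OF assms(2) nz'(2) assms(1) nz'(1)] pr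
    by fastforce
qed

section \<open>Finiteness up to associates\<close>
lemma (in domain) assocs_eq_iff:
  assumes "a \<in> carrier R" "b \<in> carrier R"
  shows "assocs R a = assocs R b \<longleftrightarrow> a \<sim> b"
proof
  assume "assocs R a = assocs R b"
  then show "a \<sim> b"
    using assms by (metis assocs_eqD associated_sym)
next
  assume "a \<sim> b"
  then show "assocs R a = assocs R b"
    using assms
    by (auto simp: eq_closure_of_def elem_def intro: associated_trans associated_sym)
qed

text \<open>
  The hypothesis on \<open>g\<close> says that the associate class of \<open>s\<close> in \<open>A\<close> is determined by that of \<open>g s\<close>
  in \<open>B\<close>, so \<open>A\<close> has no more classes in \<open>S\<close> than \<open>B\<close> has in \<open>S'\<close>.
\<close>
lemma finite_up_to_associates_transfer:
  assumes A: "domain A" and B: "domain B"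
    and S: "S \<subseteq> carrier A" and S': "S' \<subseteq> carrier B" "finite_up_to_associates B S'"
    and g: "\<And>s. s \<in> S \<Longrightarrow> g s \<in> S'"
    and assoc: "\<And>s t. \<lbrakk>s \<in> S; t \<in> S; g s \<sim>\<^bsub>B\<^esub> g t\<rbrakk> \<Longrightarrow> s \<sim>\<^bsub>A\<^esub> t"
  shows "finite_up_to_associates A S"
proof -
  have fin: "finite ((\<lambda>s. assocs B (g s)) ` S)"
  proof (rule finite_subset)
    show "(\<lambda>s. assocs B (g s)) ` S \<subseteq> assocs B ` S'" using g by blast
  qed (use S'(2) in \<open>simp add: finite_up_to_associates_def\<close>)
  have det: "assocs A s = assocs A t"
    if "s \<in> S" "t \<in> S" "assocs B (g s) = assocs B (g t)" for s t
  proof -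
    have "g s \<in> carrier B" "g t \<in> carrier B" "s \<in> carrier A" "t \<in> carrier A"
      using that(1,2) g S S'(1) by blast+
    then show ?thesis
      using that assoc domain.assocs_eq_iff[OF A, of s t] domain.assocs_eq_iff[OF B, of "g s" "g t"]
      by blast
  qed
  define h where "h = (\<lambda>s. assocs B (g s))"
  have "assocs A ` S \<subseteq> (\<lambda>c. assocs A (SOME s. s \<in> S \<and> h s = c)) ` (h ` S)"
  proof
    fix c assume "c \<in> assocs A ` S"
    then obtain s where s: "s \<in> S" "c = assocs A s" by auto
    define t where "t = (SOME t. t \<in> S \<and> h t = h s)"
    have "t \<in> S \<and> h t = h s"
      unfolding t_def by (rule someI[of _ s]) (use s in simp)
    then have "assocs A t = c" using det[of t s] s by (simp add: h_def)
    then show "c \<in> (\<lambda>c. assocs A (SOME s. s \<in> S \<and> h s = c)) ` (h ` S)" using s(1) unfolding t_def by blast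
  qed
  then show ?thesis
    using fin unfolding finite_up_to_associates_def h_def by (meson finite_imageI finite_subset)
qed

lemma finite_up_to_associates_Un:
  "\<lbrakk>finite_up_to_associates A S; finite_up_to_associates A S'\<rbrakk>
    \<Longrightarrow> finite_up_to_associates A (S \<union> S')"
  by (simp add: finite_up_to_associates_def image_Un)

lemma finite_up_to_associates_subset:
  "\<lbrakk>finite_up_to_associates A S'; S \<subseteq> S'\<rbrakk> \<Longrightarrow> finite_up_to_associates A S"
  unfolding finite_up_to_associates_def by (meson finite_subset image_mono)

section \<open>The preimage of a subring under a retraction onto a field\<close>

text \<open>
  A multiplicative way to present \<open>D + M\<close>: the ideal \<open>M\<close> is the kernel of \<open>\<rho>\<close>.
\<close>
locale retraction_pullback = domain T for T :: "('a, 'b) ring_scheme" (structure) +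
  fixes K D\<^sub>0 :: "'a set" and \<rho> :: "'a \<Rightarrow> 'a"
  assumes subfield_K: "subfield K T"
    and hom_\<rho>: "\<rho> \<in> ring_hom T T"
    and \<rho>_range: "x \<in> carrier T \<Longrightarrow> \<rho> x \<in> K"
    and \<rho>_fixes: "k \<in> K \<Longrightarrow> \<rho> k = k"
    and subring_D: "subring D\<^sub>0 T"
    and D_sub_K: "D\<^sub>0 \<subseteq> K"
    and not_field_D: "\<not> field (T\<lparr>carrier := D\<^sub>0\<rparr>)"
begin

abbreviation D :: "('a, 'b) ring_scheme" where "D \<equiv> T\<lparr>carrier := D\<^sub>0\<rparr>"

abbreviation R :: "('a, 'b) ring_scheme" where
  "R \<equiv> T\<lparr>carrier := {x \<in> carrier T. \<rho> x \<in> D\<^sub>0}\<rparr>"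

text \<open>
  The factor of \<open>x\<close> in \<open>1 + M\<close>, meaningful when \<open>\<rho> x\<close> is nonzero and thus invertible in \<open>K\<close>.
\<close>
definition \<nu> :: "'a \<Rightarrow> 'a" where "\<nu> x = inv (\<rho> x) \<otimes> x"

lemma K_closed: "k \<in> K \<Longrightarrow> k \<in> carrier T"
  using subfieldE(3)[OF subfield_K] by blast

lemma D_closed: "d \<in> D\<^sub>0 \<Longrightarrow> d \<in> carrier T"
  using D_sub_K K_closed by blast

lemma \<rho>_closed: "x \<in> carrier T \<Longrightarrow> \<rho> x \<in> carrier T"
  using \<rho>_range K_closed by blast

lemma \<rho>_mult: "\<lbrakk>x \<in> carrier T; y \<in> carrier T\<rbrakk> \<Longrightarrow> \<rho> (x \<otimes> y) = \<rho> x \<otimes> \<rho> y"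
  using ring_hom_mult[OF hom_\<rho>] by blast

lemma \<rho>_one: "\<rho> \<one> = \<one>"
  using ring_hom_one[OF hom_\<rho>] by blast

lemma \<rho>_D: "d \<in> D\<^sub>0 \<Longrightarrow> \<rho> d = d"
  using \<rho>_fixes D_sub_K by blast

lemma D_mult: "\<lbrakk>a \<in> D\<^sub>0; b \<in> D\<^sub>0\<rbrakk> \<Longrightarrow> a \<otimes> b \<in> D\<^sub>0"
  using subringE(6)[OF subring_D] by blast

lemma K_inv:
  assumes "k \<in> K" "k \<noteq> \<zero>"
  shows "inv k \<in> K" "inv k \<in> carrier T" "k \<otimes> inv k = \<one>" "inv k \<otimes> k = \<one>" "k \<in> Units T"
    "inv k \<in> Units T" "inv k \<noteq> \<zero>"
proof -
  show k: "inv k \<in> K" "k \<otimes> inv k = \<one>" "inv k \<otimes> k = \<one>" "inv k \<noteq> \<zero>"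
    using subfield_m_inv[OF subfield_K, of k] assms by auto
  then show "inv k \<in> carrier T" using K_closed by blast
  then show "k \<in> Units T" using k K_closed[OF assms(1)] unfolding Units_def by blast
  then show "inv k \<in> Units T" by simp
qed

lemma D_domain: "domain D"
  using subring_is_domain[OF subring_D] .

lemma R_subring: "subring {x \<in> carrier T. \<rho> x \<in> D\<^sub>0} T"
proof (rule subringI)
  show "\<one> \<in> {x \<in> carrier T. \<rho> x \<in> D\<^sub>0}"
    using subringE(3)[OF subring_D] \<rho>_one by simp
next
  fix h assume h: "h \<in> {x \<in> carrier T. \<rho> x \<in> D\<^sub>0}"
  interpret hom: ring_hom_ring T T \<rho>
    using hom_\<rho> ring_axioms by (intro ring_hom_ringI2) auto
  show "\<ominus> h \<in> {x \<in> carrier T. \<rho> x \<in> D\<^sub>0}"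
    using h subringE(5)[OF subring_D] by simp
next
  fix h1 h2 assume h: "h1 \<in> {x \<in> carrier T. \<rho> x \<in> D\<^sub>0}" "h2 \<in> {x \<in> carrier T. \<rho> x \<in> D\<^sub>0}"
  then show "h1 \<otimes> h2 \<in> {x \<in> carrier T. \<rho> x \<in> D\<^sub>0}"
    using D_mult \<rho>_mult by simp
  show "h1 \<oplus> h2 \<in> {x \<in> carrier T. \<rho> x \<in> D\<^sub>0}"
    using h subringE(7)[OF subring_D] ring_hom_add[OF hom_\<rho>] by simp
qed auto

lemma R_domain: "domain R"
  using subring_is_domain[OF R_subring] .

lemma D_in_R: "d \<in> D\<^sub>0 \<Longrightarrow> d \<in> carrier R"
  using D_closed \<rho>_D by simp

lemma \<rho>_zero: "\<rho> \<zero> = \<zero>"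
  using \<rho>_D subringE(2)[OF subring_D] by blast

lemma exists_nonunit_D: obtains d where "d \<in> D\<^sub>0" "d \<noteq> \<zero>" "d \<notin> Units D"
proof -
  interpret D: domain D by (rule D_domain)
  have "Units D \<noteq> carrier D - {\<zero>\<^bsub>D\<^esub>}"
    using D.cring_fieldI not_field_D by blast
  moreover have "Units D \<subseteq> carrier D - {\<zero>\<^bsub>D\<^esub>}"
    using D_closed unfolding Units_def by fastforce
  ultimately show thesis using that by auto
qed

lemma \<nu>_props:
  assumes "x \<in> carrier T" "\<rho> x \<noteq> \<zero>"
  shows "\<nu> x \<in> carrier T" "\<rho> (\<nu> x) = \<one>" "\<nu> x \<in> carrier R" "x = \<rho> x \<otimes> \<nu> x"
proof -
  note k = K_inv[OF \<rho>_range[OF assms(1)] assms(2)]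
  show c: "\<nu> x \<in> carrier T" using k assms unfolding \<nu>_def by simp
  show o: "\<rho> (\<nu> x) = \<one>" using k assms \<rho>_fixes unfolding \<nu>_def by (simp add: \<rho>_mult)
  show "\<nu> x \<in> carrier R" using c o subringE(3)[OF subring_D] by simp
  show "x = \<rho> x \<otimes> \<nu> x"
    using k assms \<rho>_closed unfolding \<nu>_def by (metis l_one m_assoc)
qed

text \<open>
  If \<open>y\<close> inverts \<open>x\<close> in \<open>T\<close>, then \<open>\<rho> y\<close> inverts \<open>\<rho> x\<close>; uniqueness of inverses puts \<open>\<rho> y\<close> into
  \<open>D\<close>, hence \<open>y\<close> into \<open>R\<close>, as soon as \<open>\<rho> x\<close> is invertible in \<open>D\<close>.
\<close>
lemma Units_R_iff:
  assumes "x \<in> carrier R"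
  shows "x \<in> Units R \<longleftrightarrow> x \<in> Units T \<and> \<rho> x \<in> Units D"
proof
  assume "x \<in> Units R"
  then obtain y where y: "y \<in> carrier T" "\<rho> y \<in> D\<^sub>0" "x \<in> carrier T" "\<rho> x \<in> D\<^sub>0" "y \<otimes> x = \<one>" "x \<otimes> y = \<one>"
    unfolding Units_def by auto
  then have "\<rho> y \<otimes> \<rho> x = \<one>" "\<rho> x \<otimes> \<rho> y = \<one>" using \<rho>_mult \<rho>_one by metis+
  then show "x \<in> Units T \<and> \<rho> x \<in> Units D" using y unfolding Units_def by auto
next
  assume "x \<in> Units T \<and> \<rho> x \<in> Units D"
  then obtain y e where y: "y \<in> carrier T" "x \<in> carrier T" "y \<otimes> x = \<one>" "x \<otimes> y = \<one>"
    and e: "e \<in> D\<^sub>0" "\<rho> x \<in> D\<^sub>0" "e \<otimes> \<rho> x = \<one>"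
    unfolding Units_def by auto
  have "\<rho> x \<otimes> \<rho> y = \<one>" using y \<rho>_mult \<rho>_one by metis
  then have "\<rho> y = e" using e y \<rho>_closed D_closed by (metis l_one m_assoc r_one)
  then show "x \<in> Units R" using y e unfolding Units_def by auto
qed

lemma Units_R_iff_Units_D:
  assumes "d \<in> D\<^sub>0"
  shows "d \<in> Units R \<longleftrightarrow> d \<in> Units D"
proof -
  have "d \<in> Units T" if "d \<in> Units D"
    using that D_closed unfolding Units_def by auto
  then show ?thesis using Units_R_iff[OF D_in_R[OF assms]] \<rho>_D[OF assms] by auto
qed

lemma Units_R_iff_Units_T:
  assumes "u \<in> carrier T" "\<rho> u = \<one>"
  shows "u \<in> Units R \<longleftrightarrow> u \<in> Units T"
proof -
  have "\<one> \<in> Units D" using subringE(3)[OF subring_D] unfolding Units_def by force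
  then show ?thesis using Units_R_iff[of u] assms subringE(3)[OF subring_D] by auto
qed

text \<open>
  The only candidate for the quotient is \<open>d\<inverse> x\<close>, whose image under \<open>\<rho>\<close> is \<open>d\<inverse> (\<rho> x)\<close>.
\<close>
lemma const_divides_R_iff:
  assumes "d \<in> D\<^sub>0" "d \<noteq> \<zero>" "x \<in> carrier R"
  shows "d divides\<^bsub>R\<^esub> x \<longleftrightarrow> d divides\<^bsub>D\<^esub> \<rho> x"
proof
  assume "d divides\<^bsub>R\<^esub> x"
  then obtain c where "c \<in> carrier T" "\<rho> c \<in> D\<^sub>0" "x = d \<otimes> c" unfolding factor_def by auto
  then show "d divides\<^bsub>D\<^esub> \<rho> x"
    using assms(1) \<rho>_mult \<rho>_D D_closed unfolding factor_def by auto
next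
  assume "d divides\<^bsub>D\<^esub> \<rho> x"
  then obtain e where e: "e \<in> D\<^sub>0" "\<rho> x = d \<otimes> e" unfolding factor_def by auto
  have dK: "d \<in> K" using assms(1) D_sub_K by blast
  note k = K_inv[OF dK assms(2)]
  have x: "x \<in> carrier T" and d: "d \<in> carrier T" using assms D_closed by auto
  have "\<rho> (inv d \<otimes> x) = inv d \<otimes> (d \<otimes> e)" using k x e \<rho>_fixes by (simp add: \<rho>_mult)
  also have "\<dots> = e" using k d e D_closed by (metis l_one m_assoc)
  finally have "inv d \<otimes> x \<in> carrier R" using k x e by simp
  moreover have "x = d \<otimes> (inv d \<otimes> x)" using k x d by (metis l_one m_assoc)
  ultimately show "d divides\<^bsub>R\<^esub> x" unfolding factor_def by auto
qed

lemma const_divides_kernel: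
  assumes "d \<in> D\<^sub>0" "d \<noteq> \<zero>" "x \<in> carrier T" "\<rho> x = \<zero>"
  shows "d divides\<^bsub>R\<^esub> x"
proof -
  have "d divides\<^bsub>D\<^esub> \<zero>"
    using assms(1) subringE(2)[OF subring_D] D_closed unfolding factor_def by force
  then show ?thesis using const_divides_R_iff assms subringE(2)[OF subring_D] by simp
qed

lemma const_divides_const_iff:
  assumes "d \<in> D\<^sub>0" "d \<noteq> \<zero>" "a \<in> D\<^sub>0"
  shows "d divides\<^bsub>R\<^esub> a \<longleftrightarrow> d divides\<^bsub>D\<^esub> a"
  using const_divides_R_iff[OF assms(1,2) D_in_R[OF assms(3)]] \<rho>_D[OF assms(3)] by simp

text \<open>
  If \<open>x = u c\<close> with \<open>\<rho> u = 1\<close>, then \<open>\<rho> c = \<rho> x\<close>, so the quotient lies in \<open>R\<close> automatically.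
\<close>
lemma unital_divides_R_iff:
  assumes "u \<in> carrier T" "\<rho> u = \<one>" "x \<in> carrier R"
  shows "u divides\<^bsub>R\<^esub> x \<longleftrightarrow> u divides\<^bsub>T\<^esub> x"
proof -
  have "c \<in> carrier R" if "c \<in> carrier T" "x = u \<otimes> c" for c
    using \<rho>_mult[OF assms(1) that(1)] that assms(2,3) \<rho>_closed[OF that(1)] by simp
  then show ?thesis unfolding factor_def by auto
qed

section \<open>Irreducible and prime elements of the preimage\<close>

text \<open>
  A factorization of a constant \<open>d\<close> in \<open>R\<close> projects to one in \<open>D\<close>. A factor whose projection is a
  unit of \<open>D\<close> is a unit of \<open>R\<close>, since it is a unit of \<open>T\<close> as a divisor of \<open>d\<close>, which is invertible
  in \<open>K\<close>.
\<close>
lemma ring_irreducible_D_iff_R: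
  assumes d: "d \<in> D\<^sub>0"
  shows "ring_irreducible\<^bsub>D\<^esub> d \<longleftrightarrow> ring_irreducible\<^bsub>R\<^esub> d"
proof
  assume irr: "ring_irreducible\<^bsub>D\<^esub> d"
  then have nz: "d \<noteq> \<zero>" by (simp add: ring_irreducible_def)
  have irr': "d \<notin> Units D" "\<And>b c. \<lbrakk>b \<in> D\<^sub>0; c \<in> D\<^sub>0; d = b \<otimes> c\<rbrakk> \<Longrightarrow> b \<in> Units D \<or> c \<in> Units D"
    using irr domain.ring_irreducible_iff[OF D_domain, of d] d by auto
  have "b \<in> Units R \<or> c \<in> Units R" if b: "b \<in> carrier R" and c: "c \<in> carrier R" and eq: "d = b \<otimes> c" for b c
  proof -
    have "d = \<rho> b \<otimes> \<rho> c" using \<rho>_D[OF d] eq b c \<rho>_mult by simp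
    then have "\<rho> b \<in> Units D \<or> \<rho> c \<in> Units D" using irr'(2) b c by auto
    moreover have "b \<in> Units T" "c \<in> Units T"
    proof -
      have dU: "d \<in> Units T" using K_inv(5)[of d] d D_sub_K nz by blast
      show "b \<in> Units T" using unit_factor[of b c] dU eq b c by simp
      show "c \<in> Units T" using unit_factor[of c b] dU eq b c m_comm[of c b] by simp
    qed
    ultimately show ?thesis using Units_R_iff b c by blast
  qed
  then show "ring_irreducible\<^bsub>R\<^esub> d"
    using domain.ring_irreducible_iff[OF R_domain D_in_R[OF d]] irr'(1) Units_R_iff_Units_D[OF d] by simp
next
  assume irr: "ring_irreducible\<^bsub>R\<^esub> d"
  have irr': "d \<notin> Units R" "\<And>b c. \<lbrakk>b \<in> carrier R; c \<in> carrier R; d = b \<otimes> c\<rbrakk> \<Longrightarrow> b \<in> Units R \<or> c \<in> Units R"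
    using irr domain.ring_irreducible_iff[OF R_domain D_in_R[OF d]] by auto
  have "b \<in> Units D \<or> c \<in> Units D" if b: "b \<in> D\<^sub>0" and c: "c \<in> D\<^sub>0" and eq: "d = b \<otimes> c" for b c
    using irr'(2)[OF D_in_R[OF b] D_in_R[OF c] eq] Units_R_iff_Units_D b c by blast
  then show "ring_irreducible\<^bsub>D\<^esub> d"
    using domain.ring_irreducible_iff[OF D_domain, of d] irr'(1) d Units_R_iff_Units_D[OF d] by simp
qed

text \<open>
  If \<open>u = b c\<close> in \<open>R\<close> with \<open>\<rho> u = 1\<close>, then \<open>\<rho> b\<close> and \<open>\<rho> c\<close> are units of \<open>D\<close>, so \<open>b\<close> and \<open>c\<close> are
  units of \<open>R\<close> exactly when they are units of \<open>T\<close>. If the factorization is in \<open>T\<close>, the constants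
  \<open>\<rho> b\<close> and \<open>\<rho> c\<close> cancel, and \<open>u = \<nu> b \<cdot> \<nu> c\<close> is a factorization in \<open>R\<close> whose
  factors are associated in \<open>T\<close> to \<open>b\<close> and \<open>c\<close>.
\<close>
lemma ring_irreducible_T_iff_R:
  assumes u: "u \<in> carrier T" "\<rho> u = \<one>"
  shows "ring_irreducible\<^bsub>T\<^esub> u \<longleftrightarrow> ring_irreducible\<^bsub>R\<^esub> u"
proof -
  have uR: "u \<in> carrier R" using u subringE(3)[OF subring_D] by simp
  have iffT: "ring_irreducible\<^bsub>T\<^esub> u \<longleftrightarrow> u \<notin> Units R \<and>
    (\<forall>b\<in>carrier T. \<forall>c\<in>carrier T. u = b \<otimes> c \<longrightarrow> b \<in> Units T \<or> c \<in> Units T)"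
    using ring_irreducible_iff[OF u(1)] Units_R_iff_Units_T[OF u] by simp
  have iffR: "ring_irreducible\<^bsub>R\<^esub> u \<longleftrightarrow> u \<notin> Units R \<and>
    (\<forall>b\<in>carrier R. \<forall>c\<in>carrier R. u = b \<otimes> c \<longrightarrow> b \<in> Units R \<or> c \<in> Units R)"
    using domain.ring_irreducible_iff[OF R_domain uR] by simp
  show ?thesis
  proof
    assume irr: "ring_irreducible\<^bsub>T\<^esub> u"
    have "b \<in> Units R \<or> c \<in> Units R"
      if b: "b \<in> carrier R" and c: "c \<in> carrier R" and eq: "u = b \<otimes> c" for b c
    proof -
      have "\<rho> b \<otimes> \<rho> c = \<one>" using u(2) eq b c \<rho>_mult by simp
      then have "\<rho> b \<in> Units D" "\<rho> c \<in> Units D"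
        using b c m_comm[OF \<rho>_closed \<rho>_closed, of b c] unfolding Units_def by auto
      then show ?thesis using irr iffT b c eq Units_R_iff by auto
    qed
    then show "ring_irreducible\<^bsub>R\<^esub> u" using iffR iffT irr by blast
  next
    assume irr: "ring_irreducible\<^bsub>R\<^esub> u"
    have "b \<in> Units T \<or> c \<in> Units T"
      if b: "b \<in> carrier T" and c: "c \<in> carrier T" and eq: "u = b \<otimes> c" for b c
    proof -
      have bc: "\<rho> b \<otimes> \<rho> c = \<one>" using u(2) eq b c \<rho>_mult by simp
      then have nz: "\<rho> b \<noteq> \<zero>" "\<rho> c \<noteq> \<zero>"
        using l_null[OF \<rho>_closed[OF c]] r_null[OF \<rho>_closed[OF b]] zero_not_one by metis+
      note nb = \<nu>_props[OF b nz(1)] and nc = \<nu>_props[OF c nz(2)]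
      have "u = (\<rho> b \<otimes> \<nu> b) \<otimes> (\<rho> c \<otimes> \<nu> c)" using eq nb(4) nc(4) by simp
      also have "\<dots> = (\<rho> b \<otimes> \<rho> c) \<otimes> (\<nu> b \<otimes> \<nu> c)"
        using nb(1) nc(1) \<rho>_closed[OF b] \<rho>_closed[OF c] by (simp add: m_ac)
      also have "\<dots> = \<nu> b \<otimes> \<nu> c" using bc nb(1) nc(1) by simp
      finally have "\<nu> b \<in> Units R \<or> \<nu> c \<in> Units R" using irr iffR nb(3) nc(3) by blast
      then have "\<nu> b \<in> Units T \<or> \<nu> c \<in> Units T"
        using Units_R_iff_Units_T nb(1,2) nc(1,2) by blast
      moreover have "\<rho> b \<in> Units T" "\<rho> c \<in> Units T"
        using K_inv(5) \<rho>_range b c nz by blast+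
      ultimately show ?thesis using nb(4) nc(4) Units_m_closed by metis
    qed
    then show "ring_irreducible\<^bsub>T\<^esub> u" using iffR iffT irr by blast
  qed
qed

text \<open>
  A nonzero nonunit \<open>d\<close> of \<open>D\<close> gives \<open>p = d q\<close> with \<open>q = d\<inverse> p\<close> in the kernel. Neither factor is
  a unit of \<open>R\<close>. Neither factor is divisible by \<open>p\<close>: the multiples of \<open>p\<close> lie in the kernel, and
  \<open>d\<close> does not; and for nonzero \<open>p\<close>, \<open>p | q\<close> would make \<open>d\<close> a unit.
\<close>
lemma kernel_not_irreducible_not_prime:
  assumes p: "p \<in> carrier T" "\<rho> p = \<zero>"
  shows "\<not> ring_irreducible\<^bsub>R\<^esub> p" "\<not> ring_prime\<^bsub>R\<^esub> p"
proof -
  obtain d where d: "d \<in> D\<^sub>0" "d \<noteq> \<zero>" "d \<notin> Units D" by (rule exists_nonunit_D)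
  have pR: "p \<in> carrier R" using p subringE(2)[OF subring_D] by simp
  have dR: "d \<in> carrier R" "d \<notin> Units R" using d D_in_R Units_R_iff_Units_D by auto
  obtain q where q: "q \<in> carrier R" "p = d \<otimes> q"
    using const_divides_kernel[OF d(1,2) p] unfolding factor_def by auto
  interpret R: domain R by (rule R_domain)
  have \<rho>q: "\<rho> q = \<zero>"
    using p(2) q \<rho>_mult[of d q] d D_closed \<rho>_D[OF d(1)] \<rho>_closed integral[of d "\<rho> q"] by auto
  have nonunit: "x \<notin> Units R" if "x \<in> carrier T" "\<rho> x = \<zero>" for x
  proof
    assume "x \<in> Units R"
    then obtain y where "y \<in> carrier T" "x \<otimes> y = \<one>" unfolding Units_def by auto
    then have "\<zero> = \<one>" using \<rho>_mult[of x y] that \<rho>_one \<rho>_closed by auto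
    then show False by simp
  qed
  show "\<not> ring_irreducible\<^bsub>R\<^esub> p"
    using domain.ring_irreducible_iff[OF R_domain pR] q dR nonunit[of q] \<rho>q by auto
  show "\<not> ring_prime\<^bsub>R\<^esub> p"
  proof
    assume "ring_prime\<^bsub>R\<^esub> p"
    then have nz: "p \<noteq> \<zero>" and "p divides\<^bsub>R\<^esub> d \<or> p divides\<^bsub>R\<^esub> q"
      using dR(1) q R.divides_refl[OF pR] unfolding ring_prime_def prime_def by auto
    then consider c where "c \<in> carrier R" "d = p \<otimes> c" | c where "c \<in> carrier R" "q = p \<otimes> c"
      unfolding factor_def by auto
    then show False
    proof cases
      case 1
      then have "\<rho> d = \<zero>" using p \<rho>_mult[of p c] \<rho>_closed by simp
      then show False using d \<rho>_D by simp
    next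
      case 2
      have dT: "d \<in> carrier T" and cT: "c \<in> carrier T" using d D_closed 2 by auto
      have "p \<otimes> \<one> = p \<otimes> (d \<otimes> c)" using q(2) 2(2) p(1) dT cT by (simp add: m_lcomm)
      then have "d \<otimes> c = \<one>" using m_lcancel[OF nz p(1), of \<one> "d \<otimes> c"] dT cT by simp
      then have "d \<in> Units R" using dR(1) 2(1) m_comm[OF dT cT] unfolding Units_def by auto
      then show False using dR(2) by simp
    qed
  qed
qed

text \<open>
  Divisibility by \<open>d\<close> in \<open>R\<close> depends only on the image under \<open>\<rho>\<close>, which is multiplicative and
  fixes \<open>D\<close>.
\<close>
lemma ring_prime_D_iff_R:
  assumes d: "d \<in> D\<^sub>0"
  shows "ring_prime\<^bsub>D\<^esub> d \<longleftrightarrow> ring_prime\<^bsub>R\<^esub> d"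
proof (cases "d = \<zero>")
  case nz: False
  have "(\<forall>a\<in>carrier D. \<forall>b\<in>carrier D. d divides\<^bsub>D\<^esub> (a \<otimes> b) \<longrightarrow> d divides\<^bsub>D\<^esub> a \<or> d divides\<^bsub>D\<^esub> b) \<longleftrightarrow>
    (\<forall>a\<in>carrier R. \<forall>b\<in>carrier R. d divides\<^bsub>R\<^esub> (a \<otimes> b) \<longrightarrow> d divides\<^bsub>R\<^esub> a \<or> d divides\<^bsub>R\<^esub> b)"
    (is "?D \<longleftrightarrow> ?R")
  proof
    assume h: ?D
    show ?R
    proof (intro ballI impI)
      fix a b assume a: "a \<in> carrier R" and b: "b \<in> carrier R" and dv: "d divides\<^bsub>R\<^esub> (a \<otimes> b)"
      have "a \<otimes> b \<in> carrier R" using a b D_mult \<rho>_mult by simp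
      then have "d divides\<^bsub>D\<^esub> (\<rho> a \<otimes> \<rho> b)"
        using const_divides_R_iff[OF d nz] dv \<rho>_mult a b by simp
      then show "d divides\<^bsub>R\<^esub> a \<or> d divides\<^bsub>R\<^esub> b"
        using h const_divides_R_iff[OF d nz] a b by simp
    qed
  next
    assume h: ?R
    show ?D
    proof (intro ballI impI)
      fix a b assume a: "a \<in> carrier D" and b: "b \<in> carrier D" and dv: "d divides\<^bsub>D\<^esub> (a \<otimes> b)"
      then have ab: "a \<in> D\<^sub>0" "b \<in> D\<^sub>0" by simp_all
      then have "d divides\<^bsub>R\<^esub> (a \<otimes> b)" using dv const_divides_const_iff[OF d nz D_mult] by blast
      then have "d divides\<^bsub>R\<^esub> a \<or> d divides\<^bsub>R\<^esub> b" using h D_in_R ab by blast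
      then show "d divides\<^bsub>D\<^esub> a \<or> d divides\<^bsub>D\<^esub> b"
        using const_divides_const_iff[OF d nz] ab by blast
    qed
  qed
  then show ?thesis
    using Units_R_iff_Units_D[OF d] unfolding ring_prime_def prime_def by simp
qed (simp add: ring_prime_def)

text \<open>
  Divisibility by \<open>u\<close> is the same in \<open>R\<close> and in \<open>T\<close>. The test for primality in \<open>T\<close> also involves
  elements outside \<open>R\<close>, but each of these becomes an element of \<open>R\<close> after multiplication by a unit
  of \<open>T\<close>.
\<close>
lemma ring_prime_T_iff_R:
  assumes u: "u \<in> carrier T" "\<rho> u = \<one>"
  shows "ring_prime\<^bsub>T\<^esub> u \<longleftrightarrow> ring_prime\<^bsub>R\<^esub> u"
proof -
  have "(\<forall>a\<in>carrier T. \<forall>b\<in>carrier T. u divides\<^bsub>T\<^esub> (a \<otimes> b) \<longrightarrow> u divides\<^bsub>T\<^esub> a \<or> u divides\<^bsub>T\<^esub> b) \<longleftrightarrow>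
    (\<forall>a\<in>carrier R. \<forall>b\<in>carrier R. u divides\<^bsub>R\<^esub> (a \<otimes> b) \<longrightarrow> u divides\<^bsub>R\<^esub> a \<or> u divides\<^bsub>R\<^esub> b)"
    (is "?T \<longleftrightarrow> ?R")
  proof
    assume h: ?T
    show ?R
    proof (intro ballI impI)
      fix a b assume a: "a \<in> carrier R" and b: "b \<in> carrier R" and dv: "u divides\<^bsub>R\<^esub> (a \<otimes> b)"
      have "a \<otimes> b \<in> carrier R" using a b D_mult \<rho>_mult by simp
      then have "u divides\<^bsub>T\<^esub> (a \<otimes> b)" using unital_divides_R_iff[OF u] dv by blast
      then show "u divides\<^bsub>R\<^esub> a \<or> u divides\<^bsub>R\<^esub> b"
        using h unital_divides_R_iff[OF u] a b by simp
    qed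
  next
    assume h: ?R
    have scale: "\<exists>k\<in>Units T. k \<otimes> x \<in> carrier R" if "x \<in> carrier T" for x
    proof (cases "\<rho> x = \<zero>")
      case True
      then show ?thesis
        using that subringE(2)[OF subring_D] by (intro bexI[of _ \<one>]) auto
    next
      case False
      then show ?thesis
        using \<nu>_props(3)[OF that False] K_inv(6)[OF \<rho>_range[OF that] False]
        unfolding \<nu>_def by blast
    qed
    have cancel: "u divides\<^bsub>T\<^esub> x" if "k \<in> Units T" "x \<in> carrier T" "u divides\<^bsub>T\<^esub> (k \<otimes> x)" for k x
      using divides_prod_l[OF u(1), of "k \<otimes> x" "inv k"] that Units_closed[OF that(1)]
      by (simp add: m_assoc[symmetric])
    show ?T
    proof (intro ballI impI)
      fix a b assume a: "a \<in> carrier T" and b: "b \<in> carrier T" and dv: "u divides\<^bsub>T\<^esub> (a \<otimes> b)"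
      obtain k l where k: "k \<in> Units T" "k \<otimes> a \<in> carrier R" and l: "l \<in> Units T" "l \<otimes> b \<in> carrier R"
        using scale a b by meson
      have "u divides\<^bsub>T\<^esub> ((k \<otimes> l) \<otimes> (a \<otimes> b))"
        using divides_prod_l[OF u(1) _ _ dv] a b k(1) l(1) Units_closed by simp
      moreover have "(k \<otimes> l) \<otimes> (a \<otimes> b) = (k \<otimes> a) \<otimes> (l \<otimes> b)"
        using a b k(1) l(1) by (simp add: m_ac Units_closed)
      moreover have "(k \<otimes> a) \<otimes> (l \<otimes> b) \<in> carrier R" using k(2) l(2) D_mult \<rho>_mult by simp
      ultimately have "u divides\<^bsub>R\<^esub> ((k \<otimes> a) \<otimes> (l \<otimes> b))" using unital_divides_R_iff[OF u] by simp
      then have "u divides\<^bsub>R\<^esub> (k \<otimes> a) \<or> u divides\<^bsub>R\<^esub> (l \<otimes> b)" using h k(2) l(2) by blast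
      then have "u divides\<^bsub>T\<^esub> (k \<otimes> a) \<or> u divides\<^bsub>T\<^esub> (l \<otimes> b)"
        using unital_divides_R_iff[OF u] k(2) l(2) by blast
      then show "u divides\<^bsub>T\<^esub> a \<or> u divides\<^bsub>T\<^esub> b" using cancel a b k(1) l(1) by blast
    qed
  qed
  then show ?thesis
    using Units_R_iff_Units_T[OF u] unfolding ring_prime_def prime_def by simp
qed

end

section \<open>Existence of divisors of a given kind\<close>

text \<open>
  The common behaviour of irreducible and prime elements. The condition \<open>P_mult_cases\<close> combines
  two facts: an element with property \<open>P\<close> is not a product of two nonunits, and \<open>P\<close> survives the
  removal of a unit factor.
\<close>
locale divisor_kind = retraction_pullback T K D\<^sub>0 \<rho>
  for T :: "('a, 'b) ring_scheme" (structure) and K D\<^sub>0 \<rho> +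
  fixes P :: "('a, 'b) ring_scheme \<Rightarrow> 'a \<Rightarrow> bool"
  assumes P_nonunit: "\<lbrakk>domain A; p \<in> carrier A; P A p\<rbrakk> \<Longrightarrow> p \<notin> Units A"
    and P_mult_cases: "\<lbrakk>domain A; a \<in> carrier A; b \<in> carrier A; P A (a \<otimes>\<^bsub>A\<^esub> b)\<rbrakk>
      \<Longrightarrow> a \<in> Units A \<and> P A b \<or> b \<in> Units A \<and> P A a"
    and P_D_iff_R: "d \<in> D\<^sub>0 \<Longrightarrow> P D d \<longleftrightarrow> P R d"
    and P_T_iff_R: "\<lbrakk>u \<in> carrier T; \<rho> u = \<one>\<rbrakk> \<Longrightarrow> P T u \<longleftrightarrow> P R u"
    and P_kernel: "\<lbrakk>p \<in> carrier T; \<rho> p = \<zero>\<rbrakk> \<Longrightarrow> \<not> P R p"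
begin

text \<open>
  Up to associates, the elements of \<open>R\<close> with property \<open>P\<close> are either constants or elements of
  \<open>1 + M\<close>.
\<close>
lemma P_R_cases:
  assumes "p \<in> carrier R" "P R p"
  obtains (const) "\<rho> p \<noteq> \<zero>" "P D (\<rho> p)" "\<nu> p \<in> Units R"
    | (unital) "\<rho> p \<noteq> \<zero>" "\<rho> p \<in> Units D" "P R (\<nu> p)"
proof -
  have p: "p \<in> carrier T" "\<rho> p \<in> D\<^sub>0" using assms(1) by auto
  have nz: "\<rho> p \<noteq> \<zero>" using P_kernel[OF p(1)] assms(2) by blast
  note n = \<nu>_props[OF p(1) nz]
  have "P R (\<rho> p \<otimes>\<^bsub>R\<^esub> \<nu> p)" using assms(2) n(4) by simp
  then have "\<rho> p \<in> Units R \<and> P R (\<nu> p) \<or> \<nu> p \<in> Units R \<and> P R (\<rho> p)"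
    by (rule P_mult_cases[OF R_domain D_in_R[OF p(2)] n(3)])
  then show thesis using that nz p(2) Units_R_iff_Units_D P_D_iff_R by blast
qed

text \<open>
  A divisor \<open>p\<close> of a nonzero constant is a unit of \<open>T\<close>, and so is \<open>\<rho> p\<close>. Hence \<open>\<nu> p\<close> is a unit, and
  \<open>p\<close> can be replaced by the constant \<open>\<rho> p\<close>.
\<close>
lemma has_divisor_R_imp_D:
  assumes "every_nonunit_has_divisor P R"
  shows "every_nonunit_has_divisor P D"
  unfolding every_nonunit_has_divisor_def
proof (intro ballI impI)
  fix d assume d: "d \<in> carrier D" "d \<noteq> \<zero>\<^bsub>D\<^esub>" "d \<notin> Units D"
  then have d0: "d \<in> D\<^sub>0" "d \<noteq> \<zero>" by auto
  have "d \<notin> Units R" using d Units_R_iff_Units_D by simp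
  then obtain p where p: "p \<in> carrier R" "P R p" "p divides\<^bsub>R\<^esub> d"
    using assms d0 D_in_R[OF d0(1)] unfolding every_nonunit_has_divisor_def by auto
  obtain c where c: "c \<in> carrier R" "d = p \<otimes> c" using p(3) unfolding factor_def by auto
  have "d = \<rho> p \<otimes> \<rho> c" using \<rho>_D[OF d0(1)] c p(1) \<rho>_mult by simp
  then have dv: "\<rho> p divides\<^bsub>D\<^esub> d" using c(1) unfolding factor_def by auto
  have pT: "p \<in> carrier T" using p(1) by simp
  have "p \<in> Units T"
    using K_inv(5)[of d] d0 D_sub_K c p(1) by (auto intro: unit_factor)
  moreover have "p = \<rho> p \<otimes> \<nu> p" "\<nu> p \<in> carrier T" "\<rho> (\<nu> p) = \<one>"
    using \<nu>_props[OF pT] P_kernel[OF pT] p(2) by blast+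
  ultimately have "\<nu> p \<in> Units T"
    using unit_factor[of "\<nu> p" "\<rho> p"] m_comm[of "\<nu> p" "\<rho> p"] \<rho>_closed[OF pT] by simp
  then have nuR: "\<nu> p \<in> Units R"
    using Units_R_iff_Units_T \<open>\<nu> p \<in> carrier T\<close> \<open>\<rho> (\<nu> p) = \<one>\<close> by blast
  show "\<exists>p\<in>carrier D. P D p \<and> p divides\<^bsub>D\<^esub> d"
    using p(1,2)
  proof (cases rule: P_R_cases)
    case const
    then show ?thesis using dv p(1) by auto
  next
    case unital
    then show ?thesis
      using P_nonunit[OF R_domain, of "\<nu> p"] nuR \<nu>_props(3)[OF pT] by auto
  qed
qed

text \<open>
  For the converse direction, let \<open>x\<close> be a nonzero nonunit of \<open>R\<close>. If \<open>\<rho> x = 0\<close>, every nonzero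
  constant divides \<open>x\<close>, and \<open>D\<close> contains one with property \<open>P\<close> because it has nonzero nonunits. If
  \<open>\<rho> x\<close> is a nonzero nonunit of \<open>D\<close>, a divisor of \<open>\<rho> x\<close> in \<open>D\<close> divides \<open>x\<close>. Otherwise \<open>x\<close> is
  associated to \<open>\<nu> x\<close>.
\<close>
lemma has_divisor_R_iff:
  "every_nonunit_has_divisor P R \<longleftrightarrow> every_nonunit_has_divisor P D \<and>
    (\<forall>u\<in>carrier T. \<rho> u = \<one> \<longrightarrow> u \<notin> Units R \<longrightarrow> (\<exists>p\<in>carrier R. P R p \<and> p divides\<^bsub>R\<^esub> u))"
  (is "?R \<longleftrightarrow> ?D \<and> ?U")
proof (intro iffI conjI)
  assume r: ?R
  then show ?D by (rule has_divisor_R_imp_D)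
  show ?U
  proof (intro ballI impI)
    fix u assume u: "u \<in> carrier T" "\<rho> u = \<one>" "u \<notin> Units R"
    then have "u \<in> carrier R" "u \<noteq> \<zero>" using subringE(3)[OF subring_D] \<rho>_zero by auto
    then show "\<exists>p\<in>carrier R. P R p \<and> p divides\<^bsub>R\<^esub> u"
      using r u(3) unfolding every_nonunit_has_divisor_def by simp
  qed
next
  assume du: "?D \<and> ?U"
  have const: "\<exists>p\<in>D\<^sub>0. p \<noteq> \<zero> \<and> P R p \<and> p divides\<^bsub>D\<^esub> d"
    if d: "d \<in> D\<^sub>0" "d \<noteq> \<zero>" "d \<notin> Units D" for d
  proof -
    obtain p where p: "p \<in> D\<^sub>0" "P D p" "p divides\<^bsub>D\<^esub> d"
      using du d unfolding every_nonunit_has_divisor_def by auto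
    then have "P R p" using P_D_iff_R by blast
    moreover have "p \<noteq> \<zero>" using \<open>P R p\<close> P_kernel[of p] p(1) D_closed \<rho>_zero by auto
    ultimately show ?thesis using p by blast
  qed
  show ?R
    unfolding every_nonunit_has_divisor_def
  proof (intro ballI impI)
    fix x assume x: "x \<in> carrier R" "x \<noteq> \<zero>\<^bsub>R\<^esub>" "x \<notin> Units R"
    have xT: "x \<in> carrier T" "\<rho> x \<in> D\<^sub>0" using x(1) by auto
    consider "\<rho> x = \<zero>" | "\<rho> x \<noteq> \<zero>" "\<rho> x \<notin> Units D" | "\<rho> x \<noteq> \<zero>" "\<rho> x \<in> Units D" by blast
    then show "\<exists>p\<in>carrier R. P R p \<and> p divides\<^bsub>R\<^esub> x"
    proof cases
      case 1
      obtain d where "d \<in> D\<^sub>0" "d \<noteq> \<zero>" "d \<notin> Units D" by (rule exists_nonunit_D)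
      then obtain p where "p \<in> D\<^sub>0" "p \<noteq> \<zero>" "P R p" using const by blast
      then show ?thesis using const_divides_kernel[OF _ _ xT(1) 1] D_in_R by blast
    next
      case 2
      then obtain p where "p \<in> D\<^sub>0" "p \<noteq> \<zero>" "P R p" "p divides\<^bsub>D\<^esub> \<rho> x" using const xT(2) by blast
      then show ?thesis using const_divides_R_iff[OF _ _ x(1)] D_in_R by blast
    next
      case 3
      note n = \<nu>_props[OF xT(1) 3(1)]
      interpret R: domain R by (rule R_domain)
      have "\<rho> x \<in> Units R" using 3(2) Units_R_iff_Units_D[OF xT(2)] by simp
      then have "\<nu> x \<notin> Units R" using R.Units_m_closed[of "\<rho> x" "\<nu> x"] n(4) x(3) by auto
      then obtain p where p: "p \<in> carrier R" "P R p" "p divides\<^bsub>R\<^esub> \<nu> x" using du n(1,2) by blast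
      have "p divides\<^bsub>R\<^esub> (\<rho> x \<otimes>\<^bsub>R\<^esub> \<nu> x)"
        using R.divides_prod_l[OF p(1) n(3) D_in_R[OF xT(2)] p(3)] .
      then show ?thesis using p(1,2) n(4) by auto
    qed
  qed
qed

text \<open>
  A divisor \<open>q\<close> in \<open>T\<close> of an element of \<open>1 + M\<close> lies outside \<open>M\<close>, so it can be scaled by a constant
  to \<open>\<nu> q\<close>, which belongs to \<open>R\<close>.
\<close>
lemma has_divisor_D_T_imp_R:
  assumes "every_nonunit_has_divisor P D" "every_nonunit_has_divisor P T"
  shows "every_nonunit_has_divisor P R"
  unfolding has_divisor_R_iff
proof (intro conjI ballI impI)
  fix u assume u: "u \<in> carrier T" "\<rho> u = \<one>" "u \<notin> Units R"
  have uR: "u \<in> carrier R" using u subringE(3)[OF subring_D] by simp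
  have "u \<notin> Units T" "u \<noteq> \<zero>" using u Units_R_iff_Units_T \<rho>_zero by auto
  then obtain q c where q: "q \<in> carrier T" "P T q" and c: "c \<in> carrier T" "u = q \<otimes> c"
    using assms(2) u(1) unfolding every_nonunit_has_divisor_def factor_def by blast
  have "\<rho> q \<otimes> \<rho> c = \<one>" using u(2) q c \<rho>_mult by simp
  then have nz: "\<rho> q \<noteq> \<zero>" using l_null[OF \<rho>_closed[OF c(1)]] zero_not_one by metis
  note n = \<nu>_props[OF q(1) nz]
  have k: "\<rho> q \<in> Units T" "\<rho> q \<in> carrier T" using K_inv(5) \<rho>_range q(1) nz \<rho>_closed by blast+
  have "P T (\<nu> q)"
    using P_mult_cases[OF domain_axioms k(2) n(1)] q(2) n(4) P_nonunit[OF domain_axioms q(1) q(2)]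
      k(1) Units_m_closed by metis
  then have "P R (\<nu> q)" using P_T_iff_R n(1,2) by blast
  moreover have "u = \<nu> q \<otimes> (\<rho> q \<otimes> c)" using c n(1,4) k(2) by (metis m_assoc m_comm)
  then have "\<nu> q divides\<^bsub>T\<^esub> u" using k(2) c(1) unfolding factor_def by blast
  then have "\<nu> q divides\<^bsub>R\<^esub> u" using unital_divides_R_iff[OF n(1,2) uR] by blast
  ultimately show "\<exists>p\<in>carrier R. P R p \<and> p divides\<^bsub>R\<^esub> u" using n(3) by blast
qed (rule assms(1))

end

section \<open>Prime divisors up to associates\<close>

context retraction_pullback
begin

lemma irreducible_kind: "divisor_kind T K D\<^sub>0 \<rho> (\<lambda>A. ring_irreducible\<^bsub>A\<^esub>)"
proof unfold_locales
  show "p \<notin> Units A" if "domain A" "p \<in> carrier A" "ring_irreducible\<^bsub>A\<^esub> p"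
    for A :: "('a, 'b) ring_scheme" and p
    using domain.ring_irreducibleE(4)[OF that] .
qed (auto simp: ring_irreducible_D_iff_R ring_irreducible_T_iff_R kernel_not_irreducible_not_prime
    dest: domain.ring_irreducible_mult_cases)

lemma prime_kind: "divisor_kind T K D\<^sub>0 \<rho> (\<lambda>A. ring_prime\<^bsub>A\<^esub>)"
proof unfold_locales
  show "p \<notin> Units A" if "domain A" "p \<in> carrier A" "ring_prime\<^bsub>A\<^esub> p"
    for A :: "('a, 'b) ring_scheme" and p
    using that(3) unfolding ring_prime_def prime_def by blast
qed (auto simp: ring_prime_D_iff_R ring_prime_T_iff_R kernel_not_irreducible_not_prime
    dest: domain.ring_prime_mult_cases)

text \<open>
  Every prime of \<open>D\<close> is a prime divisor in \<open>R\<close> of the single nonzero element \<open>m\<close> of the kernel.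
\<close>
lemma pdf_R_imp_finite_primes_D:
  assumes pdf: "pdf_domain R" and m: "m \<in> carrier T" "m \<noteq> \<zero>" "\<rho> m = \<zero>"
  shows "finite_up_to_associates D (prime_elements D)"
proof (rule finite_up_to_associates_transfer[OF D_domain R_domain])
  show "finite_up_to_associates R {p \<in> prime_elements R. p divides\<^bsub>R\<^esub> m}"
    using pdf_domain.finite_prime_divisors[OF pdf] m subringE(2)[OF subring_D] by simp
next
  fix p assume "p \<in> prime_elements D"
  then have p: "p \<in> D\<^sub>0" "ring_prime\<^bsub>D\<^esub> p" unfolding prime_elements_def by auto
  then have "p \<noteq> \<zero>" unfolding ring_prime_def by simp
  then have "p divides\<^bsub>R\<^esub> m" using const_divides_kernel p(1) m(1,3) by blast
  then show "p \<in> {p \<in> prime_elements R. p divides\<^bsub>R\<^esub> m}"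
    using p D_in_R ring_prime_D_iff_R unfolding prime_elements_def by blast
next
  fix s t assume "s \<in> prime_elements D" "t \<in> prime_elements D" and st: "s \<sim>\<^bsub>R\<^esub> t"
  then have "s \<in> D\<^sub>0" "t \<in> D\<^sub>0" "s \<noteq> \<zero>" "t \<noteq> \<zero>" unfolding prime_elements_def ring_prime_def by auto
  then show "s \<sim>\<^bsub>D\<^esub> t" using st const_divides_const_iff unfolding associated_def by blast
qed (auto simp: prime_elements_def)

text \<open>
  A prime divisor \<open>p\<close> of \<open>x\<close> in \<open>R\<close> is associated to \<open>\<rho> p\<close>, a prime of \<open>D\<close>, or to \<open>\<nu> p\<close>, a prime
  divisor of \<open>x\<close> in \<open>T\<close>. Both comparisons reflect association: on constants it agrees in \<open>R\<close> and
  \<open>D\<close>, and on \<open>1 + M\<close> it agrees in \<open>R\<close> and \<open>T\<close>.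
\<close>
lemma pdf_T_finite_primes_D_imp_pdf_R:
  assumes pdf: "pdf_domain T" and fin: "finite_up_to_associates D (prime_elements D)"
  shows "pdf_domain R"
proof (intro pdf_domain.intro[OF R_domain] pdf_domain_axioms.intro)
  fix x assume x: "x \<in> carrier R" "x \<noteq> \<zero>\<^bsub>R\<^esub>"
  interpret R: domain R by (rule R_domain)
  interpret prime: divisor_kind T K D\<^sub>0 \<rho> "(\<lambda>A. ring_prime\<^bsub>A\<^esub>)" by (rule prime_kind)
  have assoc_unit: "b \<sim>\<^bsub>R\<^esub> a \<otimes> b" "b \<sim>\<^bsub>R\<^esub> b \<otimes> a" if "a \<in> Units R" "b \<in> carrier R" for a b
  proof -
    show *: "b \<sim>\<^bsub>R\<^esub> b \<otimes> a"
      using R.associatedI2'[of "b \<otimes> a" b a] that R.associated_sym[of "b \<otimes> a" b] by simp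
    have "a \<otimes> b = b \<otimes> a" using R.m_comm[OF R.Units_closed[OF that(1)] that(2)] by simp
    with * show "b \<sim>\<^bsub>R\<^esub> a \<otimes> b" by simp
  qed
  define S where "S = {p \<in> prime_elements R. p divides\<^bsub>R\<^esub> x}"
  define S1 where "S1 = {p \<in> S. ring_prime\<^bsub>D\<^esub> (\<rho> p) \<and> \<rho> p \<noteq> \<zero> \<and> \<nu> p \<in> Units R}"
  define S2 where "S2 = {p \<in> S. \<rho> p \<in> Units D \<and> \<rho> p \<noteq> \<zero> \<and> ring_prime\<^bsub>R\<^esub> (\<nu> p)}"
  have SR: "p \<in> carrier R" if "p \<in> S" for p
    using that unfolding S_def prime_elements_def by blast
  have "S \<subseteq> S1 \<union> S2"
  proof
    fix p assume p: "p \<in> S"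
    then have "ring_prime\<^bsub>R\<^esub> p" unfolding S_def prime_elements_def by blast
    with SR[OF p] show "p \<in> S1 \<union> S2"
      by (cases rule: prime.P_R_cases) (use p in \<open>auto simp: S1_def S2_def\<close>)
  qed
  moreover have "finite_up_to_associates R S1"
  proof (rule finite_up_to_associates_transfer[OF R_domain D_domain _ _ fin, where g = \<rho>])
    fix s t assume "s \<in> S1" "t \<in> S1" and st: "\<rho> s \<sim>\<^bsub>D\<^esub> \<rho> t"
    then have s: "s \<in> carrier R" "\<rho> s \<noteq> \<zero>" "\<nu> s \<in> Units R"
      and t: "t \<in> carrier R" "\<rho> t \<noteq> \<zero>" "\<nu> t \<in> Units R"
      using SR unfolding S1_def by blast+
    have D: "\<rho> s \<in> D\<^sub>0" "\<rho> t \<in> D\<^sub>0" using s t by auto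
    have "\<rho> s \<sim>\<^bsub>R\<^esub> \<rho> t" using st D s(2) t(2) const_divides_const_iff unfolding associated_def by blast
    moreover have "\<rho> s \<sim>\<^bsub>R\<^esub> s" "\<rho> t \<sim>\<^bsub>R\<^esub> t"
      using assoc_unit(2)[OF s(3) D_in_R[OF D(1)]] assoc_unit(2)[OF t(3) D_in_R[OF D(2)]]
        \<nu>_props(4) s t by simp_all
    ultimately show "s \<sim>\<^bsub>R\<^esub> t"
      using R.associated_trans R.associated_sym s(1) t(1) D_in_R D by meson
  qed (use SR in \<open>auto simp: S1_def prime_elements_def\<close>)
  moreover have "finite_up_to_associates R S2"
  proof (rule finite_up_to_associates_transfer[OF R_domain domain_axioms, where g = \<nu>])
    show "finite_up_to_associates T {p \<in> prime_elements T. p divides\<^bsub>T\<^esub> x}"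
      using pdf_domain.finite_prime_divisors[OF pdf, of x] x by simp
  next
    fix p assume "p \<in> S2"
    then have p: "p \<in> carrier T" "\<rho> p \<noteq> \<zero>" "\<rho> p \<in> D\<^sub>0" "ring_prime\<^bsub>R\<^esub> (\<nu> p)" "p divides\<^bsub>R\<^esub> x"
    proof -
      show "p \<in> carrier T" "\<rho> p \<in> D\<^sub>0" using SR[of p] \<open>p \<in> S2\<close> unfolding S2_def by simp_all
    qed (use \<open>p \<in> S2\<close> in \<open>unfold S2_def S_def, blast\<close>)+
    note n = \<nu>_props[OF p(1,2)]
    obtain c where "c \<in> carrier T" "x = p \<otimes> c" using p(5) unfolding factor_def by auto
    then have "x = (\<rho> p \<otimes> \<nu> p) \<otimes> c" using n(4) by simp
    also have "\<dots> = \<nu> p \<otimes> (\<rho> p \<otimes> c)"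
      using n(1) \<open>c \<in> carrier T\<close> \<rho>_closed[OF p(1)] by (simp add: m_ac)
    finally have "x = \<nu> p \<otimes> (\<rho> p \<otimes> c)" .
    then have "\<nu> p divides\<^bsub>T\<^esub> x" using \<open>c \<in> carrier T\<close> \<rho>_closed[OF p(1)] unfolding factor_def by blast
    then show "\<nu> p \<in> {p \<in> prime_elements T. p divides\<^bsub>T\<^esub> x}"
      using n p(4) ring_prime_T_iff_R unfolding prime_elements_def by blast
  next
    fix s t assume "s \<in> S2" "t \<in> S2" and st: "\<nu> s \<sim>\<^bsub>T\<^esub> \<nu> t"
    then have s: "s \<in> carrier R" "s \<in> carrier T" "\<rho> s \<noteq> \<zero>" "\<rho> s \<in> Units R"
      and t: "t \<in> carrier R" "t \<in> carrier T" "\<rho> t \<noteq> \<zero>" "\<rho> t \<in> Units R"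
      using SR Units_R_iff_Units_D unfolding S2_def by force+
    note ns = \<nu>_props[OF s(2,3)] and nt = \<nu>_props[OF t(2,3)]
    have "\<nu> s \<sim>\<^bsub>R\<^esub> \<nu> t"
      using st unital_divides_R_iff ns(1-3) nt(1-3) unfolding associated_def by blast
    moreover have "\<nu> s \<sim>\<^bsub>R\<^esub> s" "\<nu> t \<sim>\<^bsub>R\<^esub> t"
      using assoc_unit(1)[OF s(4) ns(3)] assoc_unit(1)[OF t(4) nt(3)] ns(4) nt(4) by simp_all
    ultimately show "s \<sim>\<^bsub>R\<^esub> t"
      using R.associated_trans R.associated_sym s(1) t(1) ns(3) nt(3) by meson
  qed (use SR in \<open>auto simp: S2_def prime_elements_def\<close>)
  ultimately have "finite_up_to_associates R S"
    using finite_up_to_associates_Un finite_up_to_associates_subset by blast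
  then show "finite_up_to_associates R {p \<in> prime_elements R. p divides\<^bsub>R\<^esub> x}"
    unfolding S_def .
qed

end

section \<open>The retraction of a direct sum of a subfield and a maximal ideal\<close>

text \<open>
  A nonzero element of \<open>K\<close> is a unit and so cannot lie in the proper ideal \<open>M\<close>. The sum is therefore
  direct, and the projection to \<open>K\<close> is multiplicative because
  \<open>(k + m) (l + n) = k l + (k n + m (l + n))\<close>, where the last summand lies in the ideal.
\<close>
lemma (in domain) complement_retraction:
  assumes K: "subfield K R" and M: "maximalideal M R" and KM: "carrier R = K <+> M"
  obtains \<rho> where "\<rho> \<in> ring_hom R R" "\<And>x. x \<in> carrier R \<Longrightarrow> \<rho> x \<in> K"
    "\<And>k m. \<lbrakk>k \<in> K; m \<in> M\<rbrakk> \<Longrightarrow> \<rho> (k \<oplus> m) = k"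
proof -
  interpret M: maximalideal M R by (rule M)
  note Ks = subringE[OF subfieldE(1)[OF K]]
  have Kc: "k \<in> carrier R" if "k \<in> K" for k using Ks(1) that by blast
  have Mc: "m \<in> carrier R" if "m \<in> M" for m using M.Icarr that .
  have K_Int_M: "k = \<zero>" if "k \<in> K" "k \<in> M" for k
  proof (rule ccontr)
    assume "k \<noteq> \<zero>"
    then have "inv k \<in> K" "inv k \<otimes> k = \<one>" using subfield_m_inv[OF K, of k] that(1) by auto
    then have "\<one> \<in> M" using M.I_l_closed[OF that(2), of "inv k"] Kc by auto
    then show False using M.one_imp_carrier M.I_notcarr by blast
  qed
  have uniq: "k = l" if "k \<in> K" "l \<in> K" "m \<in> M" "n \<in> M" "k \<oplus> m = l \<oplus> n" for k l m n
  proof -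
    have "k \<ominus> l = n \<ominus> m"
    proof -
      have cancel: "(x \<oplus> y) \<oplus> (\<ominus> z \<oplus> \<ominus> y) = x \<ominus> z"
        if "x \<in> carrier R" "y \<in> carrier R" "z \<in> carrier R" for x y z
      proof -
        have "(x \<oplus> y) \<oplus> (\<ominus> z \<oplus> \<ominus> y) = (x \<oplus> \<ominus> z) \<oplus> (y \<oplus> \<ominus> y)"
          using that by (simp only: a_ac a_inv_closed a_closed)
        then show ?thesis using that by (simp add: r_neg minus_eq)
      qed
      have "k \<ominus> l = (k \<oplus> m) \<oplus> (\<ominus> l \<oplus> \<ominus> m)" using cancel[of k m l] that(1-4) Kc Mc by simp
      also have "\<dots> = (n \<oplus> l) \<oplus> (\<ominus> m \<oplus> \<ominus> l)"
        using that(1-5) Kc Mc a_comm[of l n] a_comm[of "\<ominus> l" "\<ominus> m"] by simp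
      also have "\<dots> = n \<ominus> m" using cancel[of n l m] that(1-4) Kc Mc by simp
      finally show ?thesis .
    qed
    moreover have "k \<ominus> l \<in> K" using that(1,2) Ks(5,7) by (simp add: minus_eq)
    moreover have "n \<ominus> m \<in> M" using that(3,4) by (simp add: minus_eq M.a_closed M.a_inv_closed)
    ultimately have "k \<ominus> l = \<zero>" using K_Int_M by simp
    then show ?thesis using that(1,2) Kc by (simp add: r_right_minus_eq)
  qed
  define \<rho> where "\<rho> x = (THE k. k \<in> K \<and> (\<exists>m\<in>M. x = k \<oplus> m))" for x
  have val: "\<rho> (k \<oplus> m) = k" if "k \<in> K" "m \<in> M" for k m
    unfolding \<rho>_def by (rule the_equality) (use that uniq in blast)+
  have dec: "\<exists>k\<in>K. \<exists>m\<in>M. x = k \<oplus> m" if "x \<in> carrier R" for x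
    using that unfolding KM set_add_def' by auto
  have hom: "\<rho> \<in> ring_hom R R"
  proof (rule ring_hom_memI)
    fix x y assume "x \<in> carrier R" "y \<in> carrier R"
    then obtain k m l n where k: "k \<in> K" "m \<in> M" "x = k \<oplus> m" and l: "l \<in> K" "n \<in> M" "y = l \<oplus> n"
      using dec by meson
    note c = Kc[OF k(1)] Mc[OF k(2)] Kc[OF l(1)] Mc[OF l(2)]
    have "x \<otimes> y = k \<otimes> l \<oplus> (k \<otimes> n \<oplus> m \<otimes> (l \<oplus> n))"
      unfolding k(3) l(3) using c by (simp add: l_distr r_distr a_ac)
    moreover have "k \<otimes> n \<oplus> m \<otimes> (l \<oplus> n) \<in> M"
      using k(2) l(2) c by (intro M.a_closed M.I_l_closed M.I_r_closed) auto
    ultimately show "\<rho> (x \<otimes> y) = \<rho> x \<otimes> \<rho> y"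
      using val Ks(6) k l by simp
    have "x \<oplus> y = (k \<oplus> l) \<oplus> (m \<oplus> n)"
      unfolding k(3) l(3) using c by (simp add: a_ac)
    then show "\<rho> (x \<oplus> y) = \<rho> x \<oplus> \<rho> y"
      using val Ks(7) k l M.a_closed by simp
  next
    show "\<rho> \<one> = \<one>" using val[of \<one> \<zero>] Ks(3) M.zero_closed by simp
  next
    fix x assume "x \<in> carrier R"
    then show "\<rho> x \<in> carrier R" using dec val Kc by metis
  qed
  show thesis
  proof (rule that[OF hom])
    show "\<rho> x \<in> K" if "x \<in> carrier R" for x using dec[OF that] val by auto
  qed (rule val)
qed

section \<open>The rings D + M\<close>

theorem theorem4p7:
  fixes T :: "('a, 'b) ring_scheme" and D\<^sub>0 K M :: "'a set" and D R :: "('a, 'b) ring_scheme"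
  assumes "domain T"
    and "subfield K T"
    and "maximalideal M T" and "M \<noteq> {\<zero>\<^bsub>T\<^esub>}"
    and "carrier T = K <+>\<^bsub>T\<^esub> M"
    and "subring D\<^sub>0 (T\<lparr>carrier := K\<rparr>)"
    and D: "D = T\<lparr>carrier := D\<^sub>0\<rparr>"
    and R: "R = T\<lparr>carrier := D\<^sub>0 <+>\<^bsub>T\<^esub> M\<rparr>"
    and "\<not> field D"
  shows
    "(furstenberg_domain R \<longleftrightarrow>
      furstenberg_domain D \<and>
      (\<forall>m\<in>M. \<one>\<^bsub>R\<^esub> \<oplus>\<^bsub>R\<^esub> m \<notin> Units R \<longrightarrow>
        (\<exists>p\<in>carrier R. ring_irreducible\<^bsub>R\<^esub> p \<and> p divides\<^bsub>R\<^esub> (\<one>\<^bsub>R\<^esub> \<oplus>\<^bsub>R\<^esub> m)))) \<and>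
    ((furstenberg_domain R \<longrightarrow> furstenberg_domain D) \<and>
      (strong_furstenberg_domain R \<longrightarrow> strong_furstenberg_domain D)) \<and>
    ((furstenberg_domain D \<and> furstenberg_domain T \<longrightarrow> furstenberg_domain R) \<and>
      (strong_furstenberg_domain D \<and> strong_furstenberg_domain T \<longrightarrow> strong_furstenberg_domain R)) \<and>
    (pdf_domain R \<longrightarrow> finite_up_to_associates D (prime_elements D)) \<and>
    (pdf_domain T \<and> finite_up_to_associates D (prime_elements D) \<longrightarrow> pdf_domain R) \<and>
    (tpdf_domain R \<longrightarrow> tpdf_domain D \<and> finite_up_to_associates D (prime_elements D)) \<and>
    (tpdf_domain T \<and> tpdf_domain D \<and> finite_up_to_associates D (prime_elements D)
      \<longrightarrow> tpdf_domain R)"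
proof -
  interpret T: domain T by (rule assms(1))
  interpret M: maximalideal M T by (rule assms(3))
  obtain \<rho> where hom: "\<rho> \<in> ring_hom T T" and range: "\<And>x. x \<in> carrier T \<Longrightarrow> \<rho> x \<in> K"
    and val: "\<And>k m. \<lbrakk>k \<in> K; m \<in> M\<rbrakk> \<Longrightarrow> \<rho> (k \<oplus>\<^bsub>T\<^esub> m) = k"
    using T.complement_retraction[OF assms(2,3,5)] by metis
  have K: "subring K T" using subfieldE(1)[OF assms(2)] .
  have DK: "D\<^sub>0 \<subseteq> K" using subringE(1)[OF assms(6)] by simp
  have Kc: "k \<in> carrier T" if "k \<in> K" for k using subringE(1)[OF K] that by blast
  have "ring (T\<lparr>carrier := K, carrier := D\<^sub>0\<rparr>)"
    using ring.subring_is_ring[OF T.subring_is_ring[OF K] assms(6)] .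
  then have D_sub: "subring D\<^sub>0 T"
    using T.ring_incl_imp_subring[of D\<^sub>0] DK Kc by auto
  have fixes_K: "\<rho> k = k" if "k \<in> K" for k
    using val[OF that M.zero_closed] Kc[OF that] by simp
  interpret retraction_pullback T K D\<^sub>0 \<rho>
    using assms(2,9) hom range fixes_K D_sub DK unfolding D
    by (intro retraction_pullback.intro retraction_pullback_axioms.intro assms(1)) blast+
  have carrier_R: "D\<^sub>0 <+>\<^bsub>T\<^esub> M = {x \<in> carrier T. \<rho> x \<in> D\<^sub>0}"
  proof (intro equalityI subsetI)
    fix x assume "x \<in> D\<^sub>0 <+>\<^bsub>T\<^esub> M"
    then obtain d m where "d \<in> D\<^sub>0" "m \<in> M" "x = d \<oplus>\<^bsub>T\<^esub> m" unfolding set_add_def' by auto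
    then show "x \<in> {x \<in> carrier T. \<rho> x \<in> D\<^sub>0}" using val DK Kc M.Icarr by auto
  next
    fix x assume x: "x \<in> {x \<in> carrier T. \<rho> x \<in> D\<^sub>0}"
    then obtain k m where "k \<in> K" "m \<in> M" "x = k \<oplus>\<^bsub>T\<^esub> m"
      using assms(5) unfolding set_add_def' by auto
    then show "x \<in> D\<^sub>0 <+>\<^bsub>T\<^esub> M" using x val unfolding set_add_def' by auto
  qed
  have unital: "{u \<in> carrier T. \<rho> u = \<one>\<^bsub>T\<^esub>} = (\<lambda>m. \<one>\<^bsub>T\<^esub> \<oplus>\<^bsub>T\<^esub> m) ` M"
  proof (intro equalityI subsetI)
    fix u assume u: "u \<in> {u \<in> carrier T. \<rho> u = \<one>\<^bsub>T\<^esub>}"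
    then obtain k m where "k \<in> K" "m \<in> M" "u = k \<oplus>\<^bsub>T\<^esub> m"
      using assms(5) unfolding set_add_def' by auto
    then show "u \<in> (\<lambda>m. \<one>\<^bsub>T\<^esub> \<oplus>\<^bsub>T\<^esub> m) ` M" using u val by auto
  next
    fix u assume "u \<in> (\<lambda>m. \<one>\<^bsub>T\<^esub> \<oplus>\<^bsub>T\<^esub> m) ` M"
    then show "u \<in> {u \<in> carrier T. \<rho> u = \<one>\<^bsub>T\<^esub>}"
      using val[OF subringE(3)[OF K]] M.Icarr by auto
  qed
  obtain m where m: "m \<in> M" "m \<noteq> \<zero>\<^bsub>T\<^esub>" using assms(4) M.zero_closed by auto
  have "\<rho> m = \<zero>\<^bsub>T\<^esub>" using val[OF subringE(2)[OF K] m(1)] M.Icarr[OF m(1)] by simp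
  note m = M.Icarr[OF m(1)] m(2) this
  have R': "R = T\<lparr>carrier := {x \<in> carrier T. \<rho> x \<in> D\<^sub>0}\<rparr>" unfolding R carrier_R ..
  interpret irr: divisor_kind T K D\<^sub>0 \<rho> "(\<lambda>A. ring_irreducible\<^bsub>A\<^esub>)" by (rule irreducible_kind)
  interpret pri: divisor_kind T K D\<^sub>0 \<rho> "(\<lambda>A. ring_prime\<^bsub>A\<^esub>)" by (rule prime_kind)
  have F: "furstenberg_domain A \<longleftrightarrow> every_nonunit_has_divisor (\<lambda>A. ring_irreducible\<^bsub>A\<^esub>) A"
    "strong_furstenberg_domain A \<longleftrightarrow> every_nonunit_has_divisor (\<lambda>A. ring_prime\<^bsub>A\<^esub>) A"
    if "A \<in> {D, R, T}" for A
    using that furstenberg_domain_iff strong_furstenberg_domain_iff D_domain R_domain assms(1)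
    unfolding D R' by blast+
  have units: "(\<forall>u\<in>carrier T. \<rho> u = \<one>\<^bsub>T\<^esub> \<longrightarrow> u \<notin> Units R \<longrightarrow>
        (\<exists>p\<in>carrier R. ring_irreducible\<^bsub>R\<^esub> p \<and> p divides\<^bsub>R\<^esub> u)) \<longleftrightarrow>
      (\<forall>m\<in>M. \<one>\<^bsub>R\<^esub> \<oplus>\<^bsub>R\<^esub> m \<notin> Units R \<longrightarrow>
        (\<exists>p\<in>carrier R. ring_irreducible\<^bsub>R\<^esub> p \<and> p divides\<^bsub>R\<^esub> (\<one>\<^bsub>R\<^esub> \<oplus>\<^bsub>R\<^esub> m)))"
  proof -
    have "\<one>\<^bsub>R\<^esub> \<oplus>\<^bsub>R\<^esub> m = \<one>\<^bsub>T\<^esub> \<oplus>\<^bsub>T\<^esub> m" for m unfolding R by simp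
    moreover have "(\<forall>u\<in>carrier T. \<rho> u = \<one>\<^bsub>T\<^esub> \<longrightarrow> Q u) \<longleftrightarrow> (\<forall>m\<in>M. Q (\<one>\<^bsub>T\<^esub> \<oplus>\<^bsub>T\<^esub> m))" for Q
    proof -
      have "(\<forall>u\<in>carrier T. \<rho> u = \<one>\<^bsub>T\<^esub> \<longrightarrow> Q u) \<longleftrightarrow> (\<forall>u\<in>{u \<in> carrier T. \<rho> u = \<one>\<^bsub>T\<^esub>}. Q u)"
        by blast
      then show ?thesis unfolding unital by simp
    qed
    ultimately show ?thesis by simp
  qed
  have p1: "furstenberg_domain R \<longleftrightarrow> furstenberg_domain D \<and>
      (\<forall>m\<in>M. \<one>\<^bsub>R\<^esub> \<oplus>\<^bsub>R\<^esub> m \<notin> Units R \<longrightarrow>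
        (\<exists>p\<in>carrier R. ring_irreducible\<^bsub>R\<^esub> p \<and> p divides\<^bsub>R\<^esub> (\<one>\<^bsub>R\<^esub> \<oplus>\<^bsub>R\<^esub> m)))"
    using irr.has_divisor_R_iff F(1)[of D] F(1)[of R] unfolding units[symmetric] D[symmetric] R'[symmetric]
    by simp
  have p2: "strong_furstenberg_domain R \<longrightarrow> strong_furstenberg_domain D"
    using pri.has_divisor_R_imp_D F(2) unfolding D[symmetric] R'[symmetric] by simp
  have p3: "furstenberg_domain D \<and> furstenberg_domain T \<longrightarrow> furstenberg_domain R"
    "strong_furstenberg_domain D \<and> strong_furstenberg_domain T \<longrightarrow> strong_furstenberg_domain R"
    using irr.has_divisor_D_T_imp_R pri.has_divisor_D_T_imp_R F
    unfolding D[symmetric] R'[symmetric] by simp_all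
  have p4: "pdf_domain R \<longrightarrow> finite_up_to_associates D (prime_elements D)"
    using pdf_R_imp_finite_primes_D[OF _ m] unfolding D[symmetric] R'[symmetric] by blast
  have p5: "pdf_domain T \<and> finite_up_to_associates D (prime_elements D) \<longrightarrow> pdf_domain R"
    using pdf_T_finite_primes_D_imp_pdf_R unfolding D[symmetric] R'[symmetric] by blast
  have pdf_D: "pdf_domain D" if "finite_up_to_associates D (prime_elements D)"
    using D_domain finite_up_to_associates_subset[OF that]
    unfolding pdf_domain_def pdf_domain_axioms_def D[symmetric] by simp
  show ?thesis
    using p1 p2 p3 p4 p5 pdf_D unfolding tpdf_domain_def by blast
qed

end
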